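(* Let $q$ be a prime power, $m$ a positive integer, and $D$ a subset of $\mathbb{F}_{q^m}^*$. Then the code $\mathcal C(M_D)$ is a minimal linear code if and only if both of the following hold: (1) the set $\overline{D}=\mathbb{F}_{q^m}^*\setminus D$ spans $\mathbb{F}_{q^m}$ as an $\mathbb{F}_q$-vector space; (2) for every $y\in\mathbb{F}_q$ and every $z\in\mathbb{F}_{q^m}^*$, one has $D_{(y,z)}\neq\emptyset$ and $P_{(y,z)}\subseteq \langle z\rangle=\{\lambda z:\lambda\in\mathbb{F}_q\}$.
   Context: $\mathrm{Tr}$ denotes the trace map $\mathrm{Tr}_{\mathbb{F}_{q^m}/\mathbb{F}_q}$. Let $V=\mathbb{F}_q\times\mathbb{F}_{q^m}$. Fix an ordering $x_1,\dots,x_{q^m-1}$ of $\mathbb{F}_{q^m}^*$ and let $f_D:\mathbb{F}_{q^m}^*\to\mathbb{F}_q$ be the characteristic function of $D$ ($f_D(x)=1$ if $x\in D$, $0$ otherwise). For $(u,v)\in V$ put $c(u,v)=(u f_D(x_i)+\mathrm{Tr}(v x_i))_{1\le i\le q^m-1}\in\mathbb{F}_q^{q^m-1}$, and let $\mathcal C(M_D)=\{c(u,v):(u,v)\in V\}$ (this is the linear code with defining set $M_D=\{(1,r):r\in D\}\cup\{(0,r):r\in\overline D\}$). The support of a vector is the set of its nonzero coordinates. A linear code $\mathcal C$ over $\mathbb{F}_q$ is minimal if for all $c,c'\in\mathcal C$ with $\mathrm{supp}(c')\subseteq\mathrm{supp}(c)$ there is $\lambda\in\mathbb{F}_q$ with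 $c'=\lambda c$. For $S\subseteq\mathbb{F}_{q^m}$ let $L(S)=\{x\in\mathbb{F}_{q^m}:\mathrm{Tr}(xs)=0\ \forall s\in S\}$. For $y\in\mathbb{F}_q$, $z\in\mathbb{F}_{q^m}^*$ define $\overline D_z=\{x\in\overline D:\mathrm{Tr}(xz)=0\}$, $D_{(y,z)}=\{x\in D:\mathrm{Tr}(xz)=-y\}$, $D_{(y,z)}D_{(y,z)}^{(-1)}=\{d_i-d_j:d_i,d_j\in D_{(y,z)}\}$, and $P_{(y,z)}=L\big(D_{(y,z)}D_{(y,z)}^{(-1)}\cup\overline D_z\big)$.
   Formalization: That minimality implies (1) and (2) is proved only when (u,v) ↦ c(u,v) is injective; this excludes just D empty, or q=2 with D={x: Tr(wx)=1}, w≠0, where the code is minimal but (2), respectively (1), fails. The converse is proved for all D. *)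

theory Defs
  imports
    Jordan_Normal_Form.Matrix
    "HOL-Number_Theory.Prime_Powers"
    "HOL-Library.Cardinality"
begin

text \<open>
  An extension of finite fields is given by two field types \<open>'k\<close> (the field with \<open>q\<close> elements)
  and \<open>'l\<close> (the field with \<open>q ^ m\<close> elements) and a field homomorphism \<open>emb :: 'k \<Rightarrow> 'l\<close>, which makes
  \<open>'l\<close> a vector space over \<open>'k\<close>.
\<close>

definition ext_scale :: "('k::field \<Rightarrow> 'l::field) \<Rightarrow> 'k \<Rightarrow> 'l \<Rightarrow> 'l" where
  "ext_scale emb a x = emb a * x"

text \<open>
  The trace is the sum of the conjugates \<open>x ^ (q ^ j)\<close>, \<open>j < m\<close>. When \<open>'l\<close> has \<open>q ^ m\<close> elements
  this sum lies in the range of the (injective) map \<open>emb\<close>, so taking the inverse is legitimate.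
\<close>

definition trace :: "('k::{field,finite} \<Rightarrow> 'l::{field,finite}) \<Rightarrow> nat \<Rightarrow> 'l \<Rightarrow> 'k" where
  "trace emb m x = inv_into UNIV emb (\<Sum>j<m. x ^ (CARD('k) ^ j))"

text \<open>Codewords are indexed by \<open>0, \<dots>, n - 1\<close>; \<open>xs\<close> lists the nonzero elements of \<open>'l\<close>.\<close>

definition codeword ::
  "('k::{field,finite} \<Rightarrow> 'l::{field,finite}) \<Rightarrow> nat \<Rightarrow> 'l set \<Rightarrow> 'l list \<Rightarrow> 'k \<Rightarrow> 'l \<Rightarrow> 'k vec" where
  "codeword emb m D xs u v =
     vec (length xs) (\<lambda>i. u * of_bool (xs ! i \<in> D) + trace emb m (v * xs ! i))"

definition code_M ::
  "('k::{field,finite} \<Rightarrow> 'l::{field,finite}) \<Rightarrow> nat \<Rightarrow> 'l set \<Rightarrow> 'l list \<Rightarrow> 'k vec set" where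
  "code_M emb m D xs = {codeword emb m D xs u v | u v. True}"

definition linear_code :: "nat \<Rightarrow> 'k::field vec set \<Rightarrow> bool" where
  "linear_code n C \<longleftrightarrow>
     C \<subseteq> carrier_vec n \<and> 0\<^sub>v n \<in> C \<and>
     (\<forall>c\<in>C. \<forall>c'\<in>C. c + c' \<in> C) \<and> (\<forall>a. \<forall>c\<in>C. a \<cdot>\<^sub>v c \<in> C)"

definition supp :: "'k::zero vec \<Rightarrow> nat set" where
  "supp c = {i. i < dim_vec c \<and> c $ i \<noteq> 0}"

definition minimal_linear_code :: "nat \<Rightarrow> 'k::field vec set \<Rightarrow> bool" where
  "minimal_linear_code n C \<longleftrightarrow>
     linear_code n C \<and>
     (\<forall>c\<in>C. \<forall>c'\<in>C. supp c' \<subseteq> supp c \<longrightarrow> (\<exists>a. c' = a \<cdot>\<^sub>v c))"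

definition trace_perp ::
  "('k::{field,finite} \<Rightarrow> 'l::{field,finite}) \<Rightarrow> nat \<Rightarrow> 'l set \<Rightarrow> 'l set" where
  "trace_perp emb m S = {x. \<forall>s\<in>S. trace emb m (x * s) = 0}"

definition co_D :: "'l::zero set \<Rightarrow> 'l set" where
  "co_D D = {x. x \<noteq> 0 \<and> x \<notin> D}"

definition co_D_slice ::
  "('k::{field,finite} \<Rightarrow> 'l::{field,finite}) \<Rightarrow> nat \<Rightarrow> 'l set \<Rightarrow> 'l \<Rightarrow> 'l set" where
  "co_D_slice emb m D z = {x \<in> co_D D. trace emb m (x * z) = 0}"

definition D_slice ::
  "('k::{field,finite} \<Rightarrow> 'l::{field,finite}) \<Rightarrow> nat \<Rightarrow> 'l set \<Rightarrow> 'k \<Rightarrow> 'l \<Rightarrow> 'l set" where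
  "D_slice emb m D y z = {x \<in> D. trace emb m (x * z) = - y}"

definition P_set ::
  "('k::{field,finite} \<Rightarrow> 'l::{field,finite}) \<Rightarrow> nat \<Rightarrow> 'l set \<Rightarrow> 'k \<Rightarrow> 'l \<Rightarrow> 'l set" where
  "P_set emb m D y z =
     trace_perp emb m
       ({d - d' | d d'. d \<in> D_slice emb m D y z \<and> d' \<in> D_slice emb m D y z} \<union> co_D_slice emb m D z)"

text \<open>
  The code has dimension \<open>m + 1\<close>, that is, the parametrisation of \<open>code_M emb m D xs\<close> by the
  \<open>(m + 1)\<close>-dimensional space \<open>'k \<times> 'l\<close> is injective. This fails precisely when the characteristic
  function of \<open>D\<close> coincides with some \<open>\<lambda>x. trace emb m (v * x)\<close> on the nonzero elements, for instance
  when \<open>D\<close> is empty; \<open>code_M emb m D xs\<close> is then a simplex code of dimension \<open>m\<close>.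
\<close>

definition full_dimension ::
  "('k::{field,finite} \<Rightarrow> 'l::{field,finite}) \<Rightarrow> nat \<Rightarrow> 'l set \<Rightarrow> 'l list \<Rightarrow> bool" where
  "full_dimension emb m D xs \<longleftrightarrow> inj (\<lambda>(u, v). codeword emb m D xs u v)"

end

theory Submission
  imports
    Defs
    "HOL-Number_Theory.Residues"
    "HOL-Computational_Algebra.Polynomial"
begin

text \<open>
  The codeword of \<open>(u, v)\<close> with \<open>v \<noteq> 0\<close> vanishes exactly on the union of \<open>D_slice u v\<close> and
  \<open>co_D_slice v\<close>, and the codeword of \<open>(u, 0)\<close> with \<open>u \<noteq> 0\<close> exactly on \<open>co_D D\<close>. If
  \<open>d\<close> is a point of \<open>D_slice u v\<close>, then the codeword of \<open>(u', v')\<close> vanishes on the first of these sets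
  if and only if \<open>v' \<in> P_set u v\<close> and \<open>u' = - trace (v' * d)\<close>, so that minimality at \<open>(u, v)\<close> says that
  \<open>P_set u v\<close> is contained in the line through \<open>v\<close>. Comparison with the codeword of \<open>(1, 0)\<close> shows that the slice is
  nonempty. Since the trace form is nondegenerate, minimality at \<open>(1, 0)\<close> says that \<open>co_D D\<close> spans.
\<close>

section \<open>Frobenius powers and the trace map\<close>

lemma field_power_card_eq_same:
  fixes x :: "'a::{field,finite}"
  shows "x ^ CARD('a) = x"
proof (cases "x = 0")
  case False
  \<comment> \<open>Multiplication by \<open>x\<close> permutes the nonzero elements, so their
    product can be cancelled.\<close>
  have "\<Prod>(UNIV - {0}) = (\<Prod>y\<in>UNIV-{0}. x * y)"
    by (rule prod.reindex_bij_witness[of _ "\<lambda>y. x * y" "\<lambda>y. y / x"]) (use False in auto)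
  also have "\<dots> = x ^ (CARD('a) - 1) * \<Prod>(UNIV - {0})"
    by (simp add: prod.distrib card_Diff_singleton)
  finally have "x ^ (CARD('a) - 1) = 1"
    by auto
  then show ?thesis
    by (metis finite_UNIV_card_ge_0 finite mult.right_neutral power_minus_mult mult.commute)
qed simp

locale finite_field_extension = field_hom emb
  for emb :: "'k::{field,finite} \<Rightarrow> 'l::{field,finite}" +
  fixes m :: nat
  assumes primepow_card: "primepow CARD('k)"
    and m_pos: "m > 0"
    and card_ext: "CARD('l) = CARD('k) ^ m"
begin

abbreviation Tr :: "'l \<Rightarrow> 'k" where
  "Tr \<equiv> trace emb m"

lemma card_gt_1: "CARD('k) > 1"
  using primepow_card primepow_gt_Suc_0 by force

text \<open>The freshman's dream in \<open>'l\<close> requires \<open>CARD('k)\<close> to be a power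
  of \<open>CHAR('l)\<close>.\<close>

lemma card_power_CHAR: "prime CHAR('l) \<and> (\<exists>n. CARD('k) = CHAR('l) ^ n)"
proof -
  obtain p n where p: "prime p" "CARD('k) = p ^ n"
    using primepow_card by (auto simp: primepow_def)
  have "CHAR('l) > 0"
    by (rule finite_imp_CHAR_pos) simp
  then have "prime CHAR('l)"
    by (rule prime_CHAR_semidom)
  moreover have "CHAR('l) dvd p ^ (n * m)"
    using CHAR_dvd_CARD[where 'a='l] by (simp add: card_ext p power_mult)
  ultimately have "CHAR('l) = p"
    using p(1) by (metis prime_dvd_power primes_dvd_imp_eq)
  with p \<open>prime CHAR('l)\<close> show ?thesis
    by auto
qed

lemma frobenius_sum:
  fixes f :: "'a \<Rightarrow> 'l"
  shows "sum f A ^ (CARD('k) ^ j) = (\<Sum>i\<in>A. f i ^ (CARD('k) ^ j))"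
proof -
  obtain n where "CARD('k) = CHAR('l) ^ n"
    using card_power_CHAR by blast
  then show ?thesis
    using card_power_CHAR freshmans_dream_sum'[of "CARD('k) ^ j" "n * j" f A] by (simp add: power_mult)
qed

lemma frobenius_add:
  fixes x y :: 'l
  shows "(x + y) ^ (CARD('k) ^ j) = x ^ (CARD('k) ^ j) + y ^ (CARD('k) ^ j)"
  using frobenius_sum[of "\<lambda>b. if b then x else y" UNIV j] by (simp add: UNIV_bool add.commute)

lemma emb_power_card: "emb a ^ (CARD('k) ^ j) = emb a"
proof (induction j)
  case (Suc j)
  have "emb a ^ CARD('k) = emb a"
    by (metis field_power_card_eq_same hom_power)
  with Suc show ?case
    by (simp add: power_mult)
qed simp

lemma inj_emb: "inj emb"
proof (rule injI)
  fix a b assume "emb a = emb b"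
  then have "emb (a - b) = 0"
    by (simp add: hom_minus)
  then show "a = b"
    by (metis eq_iff_diff_eq_0 hom_inverse hom_mult hom_one mult_zero_left right_inverse zero_neq_one)
qed

text \<open>With \<open>q = CARD('k)\<close>, the image of \<open>emb\<close> consists of roots of
  \<open>X^q - X\<close>. There are at most \<open>q\<close> roots, and the image already has
  \<open>q\<close> elements.\<close>

lemma range_emb: "range emb = {y. y ^ CARD('k) = y}"
proof (rule card_seteq)
  let ?p = "monom 1 CARD('k) - monom 1 1 :: 'l poly"
  have deg: "degree ?p \<le> CARD('k)"
    using card_gt_1 by (intro degree_diff_le) (auto simp: degree_monom_eq)
  have "coeff ?p CARD('k) = 1"
    using card_gt_1 by simp
  then have "?p \<noteq> 0"
    by (metis coeff_0 zero_neq_one)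
  then have "card {x. poly ?p x = 0} \<le> CARD('k)"
    using card_poly_roots_bound[of ?p] deg by linarith
  moreover have "card (range emb) = CARD('k)"
    by (simp add: card_image inj_emb)
  ultimately show "card {y::'l. y ^ CARD('k) = y} \<le> card (range emb)"
    by (simp add: poly_monom)
qed (use emb_power_card[of _ 1] in auto)

text \<open>Raising to the power \<open>CARD('k)\<close> shifts the conjugates cyclically, so their
  sum is fixed and \<open>inv_into\<close> in \<open>trace\<close> is a true inverse.\<close>

lemma emb_trace: "emb (Tr x) = (\<Sum>j<m. x ^ (CARD('k) ^ j))"
proof -
  have "(\<Sum>j<m. x ^ (CARD('k) ^ j)) ^ CARD('k) = (\<Sum>j<m. x ^ (CARD('k) ^ Suc j))"
    using frobenius_sum[of "\<lambda>j. x ^ (CARD('k) ^ j)" "{..<m}" 1]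
    by (simp add: mult.commute flip: power_mult)
  also have "\<dots> = (\<Sum>j<m. x ^ (CARD('k) ^ j)) + x ^ (CARD('k) ^ m) - x ^ (CARD('k) ^ 0)"
    using sum.lessThan_Suc_shift[of "\<lambda>j. x ^ (CARD('k) ^ j)" m] by (simp add: algebra_simps)
  also have "x ^ (CARD('k) ^ m) = x"
    using field_power_card_eq_same[of x] by (simp add: card_ext)
  finally have "(\<Sum>j<m. x ^ (CARD('k) ^ j)) \<in> range emb"
    unfolding range_emb by simp
  then show ?thesis
    by (simp add: trace_def f_inv_into_f)
qed

lemma trace_add: "Tr (x + y) = Tr x + Tr y"
  by (rule injD[OF inj_emb]) (simp add: emb_trace hom_add frobenius_add sum.distrib)

lemma trace_emb_mult: "Tr (emb a * x) = a * Tr x"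
  by (rule injD[OF inj_emb])
    (simp add: emb_trace hom_mult power_mult_distrib emb_power_card sum_distrib_left)

lemma trace_0 [simp]: "Tr 0 = 0"
  using trace_emb_mult[of 0 0] by simp

lemma trace_diff: "Tr (x - y) = Tr x - Tr y"
  using trace_add[of "x - y" y] by simp

text \<open>Otherwise a nonzero polynomial of degree at most \<open>CARD('k) ^ (m - 1)\<close> would
  vanish on the whole field.\<close>

lemma trace_nonzero: "\<exists>x. Tr x \<noteq> 0"
proof (rule ccontr)
  assume "\<nexists>x. Tr x \<noteq> 0"
  then have zero: "(\<Sum>j<m. x ^ (CARD('k) ^ j)) = 0" for x :: 'l
    by (metis emb_trace hom_zero)
  let ?p = "\<Sum>j<m. monom 1 (CARD('k) ^ j) :: 'l poly"
  have inj: "CARD('k) ^ i = CARD('k) ^ j \<longleftrightarrow> i = j" for i j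
    using card_gt_1 by (simp add: power_inject_exp)
  \<comment> \<open>The exponents are distinct, so the linear coefficient comes from
    \<open>j = 0\<close> alone.\<close>
  have "coeff ?p (CARD('k) ^ 0) = (\<Sum>j<m. if j = 0 then 1 else 0)"
    unfolding coeff_sum coeff_monom inj ..
  also have "\<dots> = 1"
    using m_pos by simp
  finally have "?p \<noteq> 0"
    by (metis coeff_0 zero_neq_one)
  then have "card {x. poly ?p x = 0} \<le> degree ?p"
    by (rule card_poly_roots_bound)
  also have "{x. poly ?p x = 0} = UNIV"
    using zero by (simp add: poly_sum poly_monom)
  also have "degree ?p \<le> CARD('k) ^ (m - 1)"
    using card_gt_1
    by (intro degree_sum_le) (auto simp: degree_monom_eq intro!: power_increasing)
  also have "\<dots> < CARD('l)"
    using m_pos card_gt_1 by (simp add: card_ext)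
  finally show False
    by simp
qed

lemma trace_form_nondegenerate:
  assumes "\<And>x. Tr (v * x) = 0"
  shows "v = 0"
proof (rule ccontr)
  assume "v \<noteq> 0"
  obtain x where "Tr x \<noteq> 0"
    using trace_nonzero by blast
  with assms[of "x / v"] \<open>v \<noteq> 0\<close> show False
    by simp
qed

section \<open>Spans and annihilators over the subfield\<close>

sublocale ext: vector_space "ext_scale emb"
  by standard (simp_all add: ext_scale_def hom_add hom_mult algebra_simps)

lemma trace_zero_on_span:
  assumes "x \<in> ext.span S" and "\<And>s. s \<in> S \<Longrightarrow> Tr (v * s) = 0"
  shows "Tr (v * x) = 0"
  using assms(1)
proof (induction rule: ext.span_induct_alt)
  case (step c s y)
  have "v * (ext_scale emb c s + y) = emb c * (v * s) + v * y"
    by (simp add: ext_scale_def algebra_simps)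
  with step assms(2) show ?case
    by (simp add: trace_add trace_emb_mult)
qed simp

text \<open>
  For a basis \<open>B\<close> of the span, \<open>v \<mapsto> (Tr (v * b))\<^sub>b\<close> maps the whole field into a set that has
  as many elements as the span; if the span is proper, the map has a nonzero kernel.
\<close>
lemma annihilator_of_non_spanning:
  assumes "ext.span S \<noteq> UNIV"
  obtains v where "v \<noteq> 0" and "\<And>s. s \<in> S \<Longrightarrow> Tr (v * s) = 0"
proof -
  obtain B where B: "B \<subseteq> S" "ext.independent B" "S \<subseteq> ext.span B"
    using ext.maximal_independent_subset by blast
  \<comment> \<open>Extensional functions, so that a tuple is determined by its values on
    \<open>B\<close>.\<close>
  let ?W = "B \<rightarrow>\<^sub>E (UNIV :: 'k set)"
  have "inj_on (\<lambda>c. \<Sum>b\<in>B. ext_scale emb (c b) b) ?W"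
  proof (rule inj_onI)
    fix c d assume cd: "c \<in> ?W" "d \<in> ?W"
      and eq: "(\<Sum>b\<in>B. ext_scale emb (c b) b) = (\<Sum>b\<in>B. ext_scale emb (d b) b)"
    have "(\<Sum>b\<in>B. ext_scale emb (c b - d b) b) = 0"
      using eq by (simp add: ext.scale_left_diff_distrib sum_subtractf)
    then have "c b - d b = 0" if "b \<in> B" for b
      using ext.independentD[where u = "\<lambda>b. c b - d b", OF B(2) finite subset_refl _ that] by simp
    then show "c = d"
      using cd by (intro PiE_ext[of c B _ d]) auto
  qed
  then have "card ?W = card ((\<lambda>c. \<Sum>b\<in>B. ext_scale emb (c b) b) ` ?W)"
    by (simp add: card_image)
  also have "\<dots> \<le> card (ext.span B)"
    by (intro card_mono) (auto intro: ext.span_sum simp: ext.span_scale ext.span_base)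
  also have "ext.span B \<subset> UNIV"
    using ext.span_mono[OF B(1)] assms by blast
  then have "card (ext.span B) < CARD('l)"
    by (intro psubset_card_mono) auto
  finally have less: "card ?W < CARD('l)" .
  have "\<not> inj (\<lambda>v. \<lambda>b\<in>B. Tr (v * b))"
  proof
    assume "inj (\<lambda>v. \<lambda>b\<in>B. Tr (v * b))"
    moreover have "range (\<lambda>v. \<lambda>b\<in>B. Tr (v * b)) \<subseteq> ?W"
      by auto
    ultimately have "CARD('l) \<le> card ?W"
      by (intro card_inj_on_le) (auto intro: finite_PiE)
    with less show False
      by simp
  qed
  then obtain v w where vw: "v \<noteq> w" "(\<lambda>b\<in>B. Tr (v * b)) = (\<lambda>b\<in>B. Tr (w * b))"
    by (auto simp: inj_def)
  have "Tr ((v - w) * b) = 0" if "b \<in> B" for b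
    using fun_cong[OF vw(2), of b] that by (simp add: left_diff_distrib trace_diff)
  with B(3) have "Tr ((v - w) * s) = 0" if "s \<in> S" for s
    using that by (blast intro: trace_zero_on_span)
  with vw(1) that[of "v - w"] show thesis
    by simp
qed

end

section \<open>Zero sets of codewords\<close>

locale defining_set_code = finite_field_extension emb m
  for emb :: "'k::{field,finite} \<Rightarrow> 'l::{field,finite}" and m +
  fixes D :: "'l set" and xs :: "'l list"
  assumes distinct_xs: "distinct xs" and set_xs: "set xs = UNIV - {0}" and D_nonzero: "0 \<notin> D"
begin

abbreviation cw :: "'k \<Rightarrow> 'l \<Rightarrow> 'k vec" where
  "cw \<equiv> codeword emb m D xs"

text \<open>Complements of supports, taken in the field instead of among coordinates, so that the
  ordering \<open>xs\<close> disappears.\<close>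

definition zeros :: "'k \<Rightarrow> 'l \<Rightarrow> 'l set" where
  "zeros u v = {x. x \<noteq> 0 \<and> u * of_bool (x \<in> D) + Tr (v * x) = 0}"

lemma zeros_eq: "zeros u v = D_slice emb m D u v \<union> co_D_slice emb m D v"
  using D_nonzero
  by (auto simp: zeros_def D_slice_def co_D_slice_def co_D_def mult.commute
        eq_neg_iff_add_eq_0 add.commute)

lemma zeros_snd_0: "u \<noteq> 0 \<Longrightarrow> zeros u 0 = co_D D"
  by (auto simp: zeros_def co_D_def)

lemma length_xs: "length xs = CARD('k) ^ m - 1"
proof -
  have "length xs = card (UNIV - {0::'l})"
    using distinct_card[OF distinct_xs] by (simp add: set_xs)
  then show ?thesis
    by (simp add: card_Diff_singleton card_ext)
qed

lemma cw_smult: "cw (a * u) (emb a * v) = a \<cdot>\<^sub>v cw u v"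
  by (rule eq_vecI) (simp_all add: codeword_def trace_emb_mult mult.assoc distrib_left)

lemma linear_code_code_M: "linear_code (CARD('k) ^ m - 1) (code_M emb m D xs)"
proof -
  have "cw u v \<in> carrier_vec (CARD('k) ^ m - 1)" for u v
    by (simp add: codeword_def length_xs)
  moreover have "cw 0 0 = 0\<^sub>v (CARD('k) ^ m - 1)"
    by (rule eq_vecI) (simp_all add: codeword_def length_xs)
  moreover have "cw u v + cw u' v' = cw (u + u') (v + v')" for u v u' v'
    by (rule eq_vecI) (simp_all add: codeword_def trace_add distrib_right)
  ultimately show ?thesis
    unfolding linear_code_def code_M_def using cw_smult[symmetric] by (auto; metis)
qed

lemma supp_cw_subset_iff: "supp (cw u' v') \<subseteq> supp (cw u v) \<longleftrightarrow> zeros u v \<subseteq> zeros u' v'"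
proof -
  have "x \<in> UNIV - {0} \<longleftrightarrow> (\<exists>i<length xs. x = xs ! i)" for x
    using set_xs by (metis in_set_conv_nth)
  then have nz: "x \<noteq> 0 \<longleftrightarrow> (\<exists>i<length xs. x = xs ! i)" for x
    by simp
  show ?thesis
    unfolding supp_def zeros_def nz codeword_def by auto
qed

lemma minimal_linear_code_iff:
  "minimal_linear_code (CARD('k) ^ m - 1) (code_M emb m D xs) \<longleftrightarrow>
     (\<forall>u v u' v'. zeros u v \<subseteq> zeros u' v' \<longrightarrow> (\<exists>a. cw u' v' = a \<cdot>\<^sub>v cw u v))"
  unfolding minimal_linear_code_def supp_cw_subset_iff[symmetric] code_M_def
  using linear_code_code_M[unfolded code_M_def] by blast

text \<open>The differences in \<open>P_set\<close> force \<open>Tr (v' * x)\<close> to be constant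
  on the slice. The base point \<open>d\<close> names that constant, and its negative is the first
  parameter that cancels it.\<close>

lemma P_set_iff:
  assumes "d \<in> D_slice emb m D u v"
  shows "v' \<in> P_set emb m D u v \<longleftrightarrow> zeros u v \<subseteq> zeros (- Tr (v' * d)) v'"
proof
  assume P: "v' \<in> P_set emb m D u v"
  have "Tr (v' * e) = Tr (v' * d)" if "e \<in> D_slice emb m D u v" for e
  proof -
    have "Tr (v' * (e - d)) = 0"
      using P assms that unfolding P_set_def trace_perp_def by blast
    then show ?thesis
      by (simp add: right_diff_distrib trace_diff)
  qed
  moreover have "Tr (v' * e) = 0" if "e \<in> co_D_slice emb m D v" for e
    using P that unfolding P_set_def trace_perp_def by blast
  ultimately show "zeros u v \<subseteq> zeros (- Tr (v' * d)) v'"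
    unfolding zeros_eq by (auto simp: D_slice_def co_D_slice_def mult.commute)
next
  assume sub: "zeros u v \<subseteq> zeros (- Tr (v' * d)) v'"
  have D: "Tr (v' * e) = Tr (v' * d)" if "e \<in> D_slice emb m D u v" for e
  proof -
    have "e \<in> zeros (- Tr (v' * d)) v'" "e \<in> D"
      using sub that by (auto simp: zeros_eq[of u] D_slice_def)
    then show ?thesis
      by (simp add: zeros_def)
  qed
  have co_D: "Tr (v' * e) = 0" if "e \<in> co_D_slice emb m D v" for e
  proof -
    have "e \<in> zeros (- Tr (v' * d)) v'" "e \<notin> D"
      using sub that by (auto simp: zeros_eq[of u] co_D_slice_def co_D_def)
    then show ?thesis
      by (simp add: zeros_def)
  qed
  show "v' \<in> P_set emb m D u v"
    unfolding P_set_def trace_perp_def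
    using D co_D by (auto simp: right_diff_distrib trace_diff)
qed

section \<open>Minimality and the two conditions\<close>

lemma conditions_imp_minimal:
  assumes span: "ext.span (co_D D) = UNIV"
    and slice: "\<And>y z. z \<noteq> 0 \<Longrightarrow> D_slice emb m D y z \<noteq> {}"
    and P: "\<And>y z. z \<noteq> 0 \<Longrightarrow> P_set emb m D y z \<subseteq> {ext_scale emb a z | a. True}"
  shows "minimal_linear_code (CARD('k) ^ m - 1) (code_M emb m D xs)"
  unfolding minimal_linear_code_iff
proof (intro allI impI)
  fix u v u' v' assume sub: "zeros u v \<subseteq> zeros u' v'"
  \<comment> \<open>The factor is found on the parameters; \<open>cw_smult\<close> carries it over
    to the codewords.\<close>
  have "\<exists>a. u' = a * u \<and> v' = emb a * v"
  proof (cases "v = 0")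
    case False
    obtain d where d: "d \<in> D_slice emb m D u v"
      using slice[OF False] by blast
    then have "d \<in> zeros u' v'" "d \<in> D"
      using sub by (auto simp: zeros_eq[of u] D_slice_def)
    then have u': "u' = - Tr (v' * d)"
      by (simp add: zeros_def eq_neg_iff_add_eq_0)
    with sub have "v' \<in> P_set emb m D u v"
      by (simp add: P_set_iff[OF d])
    then obtain a where a: "v' = emb a * v"
      using P[OF False] by (auto simp: ext_scale_def)
    \<comment> \<open>Evaluating at \<open>d\<close> shows that the factor relating
      \<open>v'\<close> to \<open>v\<close> also relates \<open>u'\<close> to
      \<open>u\<close>.\<close>
    have "Tr (v * d) = - u"
      using d by (simp add: D_slice_def mult.commute)
    then have "u' = a * u"
      by (simp add: u' a mult.assoc trace_emb_mult)
    with a show ?thesis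
      by blast
  next
    case True
    have "Tr (v' * x) = 0" if "x \<in> co_D D" for x
    proof -
      have "x \<in> zeros u v" "x \<notin> D"
        using that by (simp_all add: True zeros_def co_D_def)
      with sub have "x \<in> zeros u' v'"
        by blast
      with \<open>x \<notin> D\<close> show ?thesis
        by (simp add: zeros_def)
    qed
    then have "v' = 0"
      using trace_form_nondegenerate trace_zero_on_span[of _ "co_D D" v'] span by simp
    show ?thesis
    proof (cases "u = 0")
      case u: True
      \<comment> \<open>The zero codeword vanishes everywhere, so any point of \<open>D\<close>
        forces \<open>u' = 0\<close>. A nonempty slice supplies one; the parameters \<open>0\<close>
        and \<open>1\<close> are an arbitrary choice.\<close>
      obtain d where "d \<in> D_slice emb m D 0 1"
        using slice[of 1 0] by auto
      then have "d \<in> D"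
        by (simp add: D_slice_def)
      then have "d \<in> zeros u v"
        using D_nonzero by (auto simp: True u zeros_def)
      then have "d \<in> zeros u' v'"
        using sub by blast
      with True u \<open>v' = 0\<close> \<open>d \<in> D\<close> show ?thesis
        by (simp add: zeros_def)
    next
      case False
      with True \<open>v' = 0\<close> show ?thesis
        by (intro exI[of _ "u' / u"]) simp
    qed
  qed
  then show "\<exists>a. cw u' v' = a \<cdot>\<^sub>v cw u v"
    using cw_smult by blast
qed

lemma minimal_imp_conditions:
  assumes dim: "full_dimension emb m D xs"
    and min: "minimal_linear_code (CARD('k) ^ m - 1) (code_M emb m D xs)"
  shows "ext.span (co_D D) = UNIV"
    and "z \<noteq> 0 \<Longrightarrow> D_slice emb m D y z \<noteq> {}"
    and "z \<noteq> 0 \<Longrightarrow> P_set emb m D y z \<subseteq> {ext_scale emb a z | a. True}"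
proof -
  \<comment> \<open>Full dimension turns proportional codewords into proportional
    parameters.\<close>
  have proportional: "\<exists>a. u' = a * u \<and> v' = emb a * v" if sub: "zeros u v \<subseteq> zeros u' v'" for u v u' v'
  proof -
    obtain a where "cw u' v' = a \<cdot>\<^sub>v cw u v"
      using min sub unfolding minimal_linear_code_iff by blast
    then have "cw u' v' = cw (a * u) (emb a * v)"
      by (simp add: cw_smult)
    with dim have "u' = a * u \<and> v' = emb a * v"
      by (auto simp: full_dimension_def inj_def)
    then show ?thesis
      by blast
  qed
  show "ext.span (co_D D) = UNIV"
  proof (rule ccontr)
    assume "ext.span (co_D D) \<noteq> UNIV"
    then obtain v where v: "v \<noteq> 0" "\<And>s. s \<in> co_D D \<Longrightarrow> Tr (v * s) = 0"
      using annihilator_of_non_spanning by blast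
    \<comment> \<open>An annihilator of \<open>co_D D\<close> gives a word \<open>(0, v)\<close>
      that is no multiple of \<open>(1, 0)\<close>.\<close>
    then have "zeros 1 0 \<subseteq> zeros 0 v"
      by (auto simp: zeros_snd_0 zeros_def co_D_def)
    from proportional[OF this] \<open>v \<noteq> 0\<close> show False
      by simp
  qed
  assume z: "z \<noteq> 0"
  show "D_slice emb m D y z \<noteq> {}"
  proof
    assume "D_slice emb m D y z = {}"
    \<comment> \<open>All zeros now lie off \<open>D\<close>, where \<open>(1, 0)\<close> vanishes.
      Its second parameter then forces the factor to be zero, its first forbids this.\<close>
    then have "zeros y z \<subseteq> zeros 1 0"
      by (auto simp: zeros_eq[of y] zeros_snd_0 co_D_slice_def)
    from proportional[OF this] obtain a where "1 = a * y" "0 = emb a * z"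
      by auto
    with z have "emb a = emb 0" "a \<noteq> 0"
      by auto
    then show False
      using inj_emb by (metis injD)
  qed
  then obtain d where d: "d \<in> D_slice emb m D y z"
    by blast
  show "P_set emb m D y z \<subseteq> {ext_scale emb a z | a. True}"
  proof
    fix v' assume "v' \<in> P_set emb m D y z"
    then have "zeros y z \<subseteq> zeros (- Tr (v' * d)) v'"
      by (simp add: P_set_iff[OF d])
    from proportional[OF this] show "v' \<in> {ext_scale emb a z | a. True}"
      by (auto simp: ext_scale_def)
  qed
qed

end

text \<open>The forward direction is confined to full dimension: for empty \<open>D\<close> the code
  is a simplex code, which is minimal although every slice is empty.\<close>

theorem theorem2:
  fixes emb :: "'k::{field,finite} \<Rightarrow> 'l::{field,finite}"
    and q m :: nat and D :: "'l set" and xs :: "'l list"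
  assumes "primepow q" and "m > 0"
    and "CARD('k) = q" and "CARD('l) = q ^ m" and "field_hom emb"
    and "distinct xs" and "set xs = UNIV - {0}"
    and "D \<subseteq> UNIV - {0}"
  shows "let minimal = minimal_linear_code (q ^ m - 1) (code_M emb m D xs);
             cond1 = (module.span (ext_scale emb) (co_D D) = UNIV);
             cond2 = (\<forall>y z. z \<noteq> 0 \<longrightarrow>
                        D_slice emb m D y z \<noteq> {} \<and>
                        P_set emb m D y z \<subseteq> {ext_scale emb a z | a. True})
         in (full_dimension emb m D xs \<longrightarrow> (minimal \<longleftrightarrow> cond1 \<and> cond2)) \<and>
            (cond1 \<and> cond2 \<longrightarrow> minimal)"
proof -
  interpret field_hom emb by fact
  interpret defining_set_code emb m D xs
    by standard (use assms in auto)
  show ?thesis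
    unfolding Let_def assms(3)[symmetric]
    using minimal_imp_conditions conditions_imp_minimal by metis
qed

end
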